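(* For every integer $n\ge 0$, there is a bijection between the set of doubly rooted plane trees with $n$ edges and the set of free Dyck paths of length $2n$.
   Context: A plane tree is a rooted tree in which the children of each vertex are linearly ordered (left to right). A doubly rooted plane tree is a plane tree together with a distinguished vertex (any vertex, possibly the root). A free Dyck path of length $2n$ is a lattice path from $(0,0)$ to $(2n,0)$ consisting of $n$ up steps $(1,1)$ and $n$ down steps $(1,-1)$, with no further restriction. *)

theory Defs
  imports Main "HOL-Library.Product_Plus"
begin

datatype plane_tree = Node (children: "plane_tree list")

text \<open>A vertex is encoded by its address: the list of child positions (counted from 0, left to
  right) met on the way from the root, so that the root is \<open>[]\<close>. Since a plane tree has no
  nontrivial automorphisms, distinct addresses in the same tree give distinct doubly rooted
  plane trees.\<close>

fun is_vertex :: "plane_tree \<Rightarrow> nat list \<Rightarrow> bool" where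
  "is_vertex t [] \<longleftrightarrow> True"
| "is_vertex t (i # p) \<longleftrightarrow> i < length (children t) \<and> is_vertex (children t ! i) p"

definition vertices :: "plane_tree \<Rightarrow> nat list set" where
  "vertices t = {p. is_vertex t p}"

definition edges :: "plane_tree \<Rightarrow> (nat list \<times> nat list) set" where
  "edges t = {(p, q). p \<in> vertices t \<and> q \<in> vertices t \<and> (\<exists>i. q = p @ [i])}"

definition doubly_rooted_plane_trees :: "nat \<Rightarrow> (plane_tree \<times> nat list) set" where
  "doubly_rooted_plane_trees n = {(t, v). card (edges t) = n \<and> v \<in> vertices t}"

text \<open>A lattice path starting at the origin is encoded by its list of step vectors, so its end point
  is the sum of that list.\<close>

definition free_dyck_paths :: "nat \<Rightarrow> (int \<times> int) list set" where
  "free_dyck_paths n =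
    {w. set w \<subseteq> {(1, 1), (1, -1)} \<and>
        count_list w (1, 1) = n \<and> count_list w (1, -1) = n \<and>
        sum_list w = (2 * int n, 0)}"

text \<open>Finiteness ensures that \<open>card (edges t)\<close> really counts the edges.\<close>

lemma finite_vertices: "finite (vertices t)"
proof (induction t)
  case (Node ts)
  have "vertices (Node ts) \<subseteq> insert [] (\<Union>i<length ts. (#) i ` vertices (ts ! i))"
  proof
    fix p assume "p \<in> vertices (Node ts)"
    then show "p \<in> insert [] (\<Union>i<length ts. (#) i ` vertices (ts ! i))"
      by (cases p) (auto simp: vertices_def)
  qed
  moreover have "finite (vertices (ts ! i))" if "i < length ts" for i
    using Node that by simp
  ultimately show ?case
    by (auto intro: finite_subset)
qed

lemma finite_edges: "finite (edges t)"
  by (rule finite_subset[of _ "vertices t \<times> vertices t"])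
    (auto simp: edges_def finite_vertices)

end

theory Submission
  imports Defs
begin

text \<open>Read the contour of the tree, an up step when descending along an edge and a down step when
  returning, but exchange the two steps for the edges on the path from the root to the marked
  vertex. If that path has \<open>k\<close> edges, the result is
  \<open>L\<^sub>1 D L\<^sub>2 D \<dots> L\<^sub>k D F U R\<^sub>k U \<dots> R\<^sub>2 U R\<^sub>1\<close>
  where the \<open>L\<^sub>i\<close>, \<open>R\<^sub>i\<close> and \<open>F\<close> are ordinary Dyck paths. Every free Dyck path of minimal height
  \<open>-k\<close> has exactly one such factorisation: the steps \<open>D\<close> are the first passages to the heights
  \<open>-1, \<dots>, -k\<close>, and the steps \<open>U\<close> are the last passages back.\<close>

section \<open>Heights and contour words\<close>

abbreviation up_step :: "int \<times> int" where "up_step \<equiv> (1, 1)"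

abbreviation down_step :: "int \<times> int" where "down_step \<equiv> (1, -1)"

definition height :: "(int \<times> int) list \<Rightarrow> int" where
  "height w = sum_list (map snd w)"

lemma height_simps [simp]:
  "height [] = 0"
  "height (s # w) = snd s + height w"
  "height (v @ w) = height v + height w"
  by (simp_all add: height_def)

fun forest_word :: "plane_tree list \<Rightarrow> (int \<times> int) list" where
  "forest_word [] = []"
| "forest_word (Node us # ts) = up_step # forest_word us @ down_step # forest_word ts"

text \<open>The factorisation is built from the outside in: at each edge of the marked path the
  siblings to the left give \<open>L\<^sub>i\<close> and those to the right
  \<open>R\<^sub>i\<close>; the children of the marked vertex give \<open>F\<close>.\<close>

fun pointed_tree_word :: "plane_tree \<Rightarrow> nat list \<Rightarrow> (int \<times> int) list" where
  "pointed_tree_word t [] = forest_word (children t)"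
| "pointed_tree_word t (i # p) =
    forest_word (take i (children t)) @ down_step # pointed_tree_word (children t ! i) p @
    up_step # forest_word (drop (Suc i) (children t))"

lemma forest_word_append [simp]: "forest_word (ss @ ts) = forest_word ss @ forest_word ts"
  by (induction ss rule: forest_word.induct) simp_all

lemma height_forest_word [simp]: "height (forest_word ts) = 0"
  by (induction ts rule: forest_word.induct) simp_all

lemma height_pointed_tree_word: "height (pointed_tree_word t p) = 0"
  by (induction t p rule: pointed_tree_word.induct) simp_all

lemma set_forest_word: "set (forest_word ts) \<subseteq> {up_step, down_step}"
  by (induction ts rule: forest_word.induct) simp_all

lemma set_pointed_tree_word: "set (pointed_tree_word t p) \<subseteq> {up_step, down_step}"
  by (induction t p rule: pointed_tree_word.induct) (simp_all add: set_forest_word)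

lemma height_take_forest_word: "0 \<le> height (take k (forest_word ts))"
proof (induction ts arbitrary: k rule: forest_word.induct)
  case (2 us ts)
  show ?case
  proof (cases k)
    case (Suc j)
    \<comment> \<open>The two instances treat a prefix that ends before the closing down step of the
      first tree and one that contains this step.\<close>
    then show ?thesis
      using 2(1)[of j] 2(2)[of "j - length (forest_word us) - 1"]
      by (cases "j - length (forest_word us)") simp_all
  qed simp
qed simp

lemma height_prefix_forest_word: "forest_word ts = v @ w \<Longrightarrow> 0 \<le> height v"
  using height_take_forest_word[of "length v" ts] by simp

lemma height_suffix_forest_word: "forest_word ts = v @ w \<Longrightarrow> height w \<le> 0"
  using height_prefix_forest_word[of ts v w] height_forest_word[of ts] by simp

section \<open>Uniqueness of the factorisation\<close>

text \<open>If one forest word were longer, the other one followed by a down step would be a prefix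
  of it, of height -1.\<close>

lemma first_passage_unique:
  assumes "forest_word ss @ down_step # v = forest_word ts @ down_step # w"
  shows "forest_word ss = forest_word ts \<and> v = w"
proof -
  have no_longer: False
    if "forest_word ts = forest_word ss @ us" "us @ down_step # w = down_step # v" "us \<noteq> []"
    for ss ts us v w
    using that height_prefix_forest_word[of ts "forest_word ss @ [down_step]" "tl us"]
    by (cases us) auto
  from assms obtain us where
    "forest_word ss = forest_word ts @ us \<and> us @ down_step # v = down_step # w \<or>
     forest_word ts = forest_word ss @ us \<and> us @ down_step # w = down_step # v"
    unfolding append_eq_append_conv2 by metis
  moreover from this have "us = []"
    using no_longer by blast
  ultimately show ?thesis
    by auto
qed

text \<open>Mirror image: the longer forest word would have a suffix of height 1.\<close>

lemma last_passage_unique: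
  assumes "v @ up_step # forest_word ss = w @ up_step # forest_word ts"
  shows "forest_word ss = forest_word ts \<and> v = w"
proof -
  have no_longer: False
    if "w = v @ us" "up_step # forest_word ss = us @ up_step # forest_word ts" "us \<noteq> []"
    for ss ts us v w
    using that height_suffix_forest_word[of ss "tl us" "up_step # forest_word ts"]
    by (cases us) auto
  from assms obtain us where
    "v = w @ us \<and> us @ up_step # forest_word ss = up_step # forest_word ts \<or>
     w = v @ us \<and> up_step # forest_word ss = us @ up_step # forest_word ts"
    unfolding append_eq_append_conv2 by metis
  moreover from this have "us = []"
    using no_longer by metis
  ultimately show ?thesis
    by auto
qed

text \<open>Behind the leading up step, the matching down step is the first passage to -1, which
  separates the first tree from the rest.\<close>

lemma forest_word_inject: "forest_word ss = forest_word ts \<Longrightarrow> ss = ts"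
proof (induction ss arbitrary: ts rule: forest_word.induct)
  case 1
  then show ?case
    by (cases ts rule: forest_word.cases) simp_all
next
  case (2 us ss)
  then show ?case
    by (cases ts rule: forest_word.cases) (auto dest: first_passage_unique)
qed

text \<open>This tells the empty address from all others.\<close>

lemma forest_word_neq_first_passage: "forest_word ts \<noteq> forest_word ss @ down_step # w"
  using height_prefix_forest_word[of ts "forest_word ss @ [down_step]" w] by auto

lemma plane_tree_eqI: "children s = children t \<Longrightarrow> s = t"
  by (rule plane_tree.expand)

text \<open>The first passage to -1 recovers the left siblings and the last passage back the right
  ones; between them lies the word of a smaller pointed tree.\<close>

lemma pointed_tree_word_inject:
  assumes "is_vertex s p" "is_vertex t q" "pointed_tree_word s p = pointed_tree_word t q"
  shows "s = t \<and> p = q"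
  using assms
proof (induction s p arbitrary: t q rule: pointed_tree_word.induct)
  case (1 s)
  then show ?case
    by (cases q)
      (auto intro: plane_tree_eqI dest: forest_word_inject simp: forest_word_neq_first_passage)
next
  case (2 s i p)
  show ?case
  proof (cases q)
    case Nil
    with 2 show ?thesis
      by (metis forest_word_neq_first_passage pointed_tree_word.simps)
  next
    case (Cons j q')
    have i: "i < length (children s)" and j: "j < length (children t)"
      using 2 Cons by simp_all
    have left: "forest_word (take i (children s)) = forest_word (take j (children t))"
      and rest: "pointed_tree_word (children s ! i) p @ up_step # forest_word (drop (Suc i) (children s)) =
        pointed_tree_word (children t ! j) q' @ up_step # forest_word (drop (Suc j) (children t))"
      using first_passage_unique[of "take i (children s)" _ "take j (children t)"] 2(4) Cons
      by simp_all
    from left have take: "take i (children s) = take j (children t)"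
      by (rule forest_word_inject)
    \<comment> \<open>The lengths are \<open>i\<close> and \<open>j\<close>, since both are valid
      child positions and \<open>take\<close> truncates nothing.\<close>
    then have "length (take i (children s)) = length (take j (children t))"
      by simp
    then have "i = j"
      using i j by simp
    from last_passage_unique[OF rest] have drop: "drop (Suc i) (children s) = drop (Suc j) (children t)"
      and "pointed_tree_word (children s ! i) p = pointed_tree_word (children t ! j) q'"
      by (auto dest: forest_word_inject)
    then have "children s ! i = children t ! j \<and> p = q'"
      using 2 Cons by (intro 2(1)) simp_all
    then show ?thesis
      using take drop i j \<open>i = j\<close> Cons
      by (metis id_take_nth_drop plane_tree_eqI)
  qed
qed

section \<open>Existence of the factorisation\<close>

text \<open>The cases may overlap. Parsing from the left, a leading down step is a first passage; a
  leading up step is matched by a later down step, or else it or a later up step is a last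
  passage.\<close>

lemma passage_cases:
  assumes "set w \<subseteq> {up_step, down_step}"
  obtains (no_passage) ts where "w = forest_word ts"
  | (first_passage) ts v where "w = forest_word ts @ down_step # v"
  | (last_passage) v ts where "w = v @ up_step # forest_word ts"
  using assms
proof (induction w arbitrary: thesis rule: length_induct)
  case (1 w)
  show ?case
  proof (cases w)
    case Nil
    then show ?thesis
      using 1(2)[of "[]"] by simp
  next
    case (Cons s w')
    show ?thesis
    proof (cases "s = down_step")
      case True
      then show ?thesis
        using Cons 1(3)[of "[]"] by simp
    next
      case False
      then have w: "w = up_step # w'" and w': "set w' \<subseteq> {up_step, down_step}"
        using Cons 1(5) by auto
      consider ts where "w' = forest_word ts"
        | ts v where "w' = forest_word ts @ down_step # v"
        | v ts where "w' = v @ up_step # forest_word ts"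
        using 1(1) w w' by (metis length_Cons lessI)
      then show ?thesis
      proof cases
        case (1 ts)
        then show ?thesis
          using w "1.prems"(3)[of "[]" ts] by simp
      next
        \<comment> \<open>The leading up step is now closed and yields the tree
          \<open>Node us\<close>; the shorter rest \<open>v\<close> is parsed again and this tree's
          word put in front.\<close>
        case (2 us v)
        then have "length v < length w" "set v \<subseteq> {up_step, down_step}"
          using w w' by auto
        then consider ts where "v = forest_word ts"
          | ts v' where "v = forest_word ts @ down_step # v'"
          | v' ts where "v = v' @ up_step # forest_word ts"
          using "1.IH" by metis
        then show ?thesis
        proof cases
          case (1 ts)
          then show ?thesis
            using w 2 "1.prems"(1)[of "Node us # ts"] by simp
        next
          case (2 ts v')
          then show ?thesis
            using w \<open>w' = _\<close> "1.prems"(2)[of "Node us # ts" v'] by simp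
        next
          case (3 v' ts)
          then show ?thesis
            using w 2 "1.prems"(3)[of "up_step # forest_word us @ down_step # v'" ts] by simp
        qed
      next
        case (3 v ts)
        then show ?thesis
          using w "1.prems"(3)[of "up_step # v" ts] by simp
      qed
    qed
  qed
qed

text \<open>Positive height excludes a forest word. What follows a first passage is shorter and
  higher by one, so induction applies.\<close>

lemma last_passage_exists:
  assumes "set w \<subseteq> {up_step, down_step}" "0 < height w"
  shows "\<exists>v ts. w = v @ up_step # forest_word ts"
  using assms
proof (induction w rule: length_induct)
  case (1 w)
  from 1(2) show ?case
  proof (cases w rule: passage_cases)
    case (first_passage ts v)
    then obtain v' ts' where "v = v' @ up_step # forest_word ts'"
      using 1 by fastforce
    then have "w = (forest_word ts @ down_step # v') @ up_step # forest_word ts'"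
      using first_passage by simp
    then show ?thesis
      by blast
  qed (use 1 in auto)
qed

text \<open>Dually, what precedes a last passage is shorter and has height
  \<open>height w - 1\<close>.\<close>

lemma first_passage_exists:
  assumes "set w \<subseteq> {up_step, down_step}" "height w < 0"
  shows "\<exists>ts v. w = forest_word ts @ down_step # v"
  using assms
proof (induction w rule: length_induct)
  case (1 w)
  from 1(2) show ?case
  proof (cases w rule: passage_cases)
    case (last_passage v ts)
    then obtain ts' v' where "v = forest_word ts' @ down_step # v'"
      using 1 by fastforce
    then show ?thesis
      using last_passage by auto
  qed (use 1 in auto)
qed

lemma pointed_tree_word_surj:
  assumes "set w \<subseteq> {up_step, down_step}" "height w = 0"
  shows "\<exists>t p. is_vertex t p \<and> w = pointed_tree_word t p"
  using assms
proof (induction w rule: length_induct)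
  case (1 w)
  \<comment> \<open>Without the outermost down and up steps, a shorter word of height 0 remains. Its
    tree becomes the child at position \<open>length ss\<close>, right after the trees
    \<open>ss\<close>.\<close>
  have spine: ?case if w: "w = forest_word ss @ down_step # v @ up_step # forest_word ts" for ss v ts
  proof -
    have "length v < length w" "set v \<subseteq> {up_step, down_step}" "height v = 0"
      using 1 w by auto
    then obtain t p where "is_vertex t p" "v = pointed_tree_word t p"
      using 1 by blast
    then have "is_vertex (Node (ss @ t # ts)) (length ss # p) \<and>
        w = pointed_tree_word (Node (ss @ t # ts)) (length ss # p)"
      using w by simp
    then show ?thesis
      by blast
  qed
  from 1(2) show ?case
  proof (cases w rule: passage_cases)
    case (no_passage ts)
    then have "is_vertex (Node ts) [] \<and> w = pointed_tree_word (Node ts) []"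
      by simp
    then show ?thesis
      by blast
  next
    case (first_passage ss v)
    \<comment> \<open>The down step leaves height 1 for \<open>v\<close>, which forces a last
      passage.\<close>
    then have "set v \<subseteq> {up_step, down_step}" "0 < height v"
      using 1 by auto
    then show ?thesis
      using first_passage spine by (metis last_passage_exists)
  next
    case (last_passage v ts)
    then have "set v \<subseteq> {up_step, down_step}" "height v < 0"
      using 1 by auto
    then obtain ss v' where "v = forest_word ss @ down_step # v'"
      using first_passage_exists by blast
    then show ?thesis
      using last_passage spine[of ss v' ts] by simp
  qed
qed

section \<open>Counting vertices, edges and steps\<close>

lemma vertices_Node: "vertices (Node ts) = insert [] (\<Union>i<length ts. (#) i ` vertices (ts ! i))"
proof (rule set_eqI)
  show "p \<in> vertices (Node ts) \<longleftrightarrow> p \<in> insert [] (\<Union>i<length ts. (#) i ` vertices (ts ! i))" for p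
    by (cases p) (auto simp: vertices_def)
qed

lemma card_vertices_Node: "card (vertices (Node ts)) = Suc (\<Sum>t\<leftarrow>ts. card (vertices t))"
proof -
  have "card (\<Union>i<length ts. (#) i ` vertices (ts ! i)) = (\<Sum>i<length ts. card (vertices (ts ! i)))"
    by (subst card_UN_disjoint) (auto simp: finite_vertices card_image)
  also have "\<dots> = (\<Sum>t\<leftarrow>ts. card (vertices t))"
    by (simp add: sum_list_sum_nth atLeast0LessThan)
  finally show ?thesis
    unfolding vertices_Node by (subst card_insert_disjoint) (auto simp: finite_vertices)
qed

lemma is_vertex_prefix: "is_vertex t (p @ q) \<Longrightarrow> is_vertex t p"
  by (induction t p rule: is_vertex.induct) simp_all

text \<open>Each vertex other than the root is the lower end of exactly one edge, the one from its
  \<open>butlast\<close>.\<close>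

lemma card_vertices: "card (vertices t) = Suc (card (edges t))"
proof -
  have "bij_betw snd (edges t) (vertices t - {[]})"
  proof (rule bij_betw_imageI)
    show "inj_on snd (edges t)"
      by (auto simp: inj_on_def edges_def)
    have "q \<in> snd ` edges t" if "q \<in> vertices t" "q \<noteq> []" for q
    proof -
      have "(butlast q, q) \<in> edges t"
        using that is_vertex_prefix[of t "butlast q" "[last q]"]
        by (auto simp: edges_def vertices_def intro!: exI[of _ "last q"])
      then show ?thesis
        by force
    qed
    then show "snd ` edges t = vertices t - {[]}"
      by (auto simp: edges_def)
  qed
  then have "card (edges t) = card (vertices t - {[]})"
    by (rule bij_betw_same_card)
  moreover have "[] \<in> vertices t"
    by (simp add: vertices_def)
  ultimately show ?thesis
    by (metis card.remove finite_vertices)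
qed

text \<open>Each vertex of the forest, roots included, contributes the two steps of the edge above
  it.\<close>

lemma length_forest_word: "length (forest_word ts) = 2 * (\<Sum>t\<leftarrow>ts. card (vertices t))"
  by (induction ts rule: forest_word.induct) (simp_all add: card_vertices_Node)

lemma length_pointed_tree_word:
  "is_vertex t p \<Longrightarrow> length (pointed_tree_word t p) = 2 * card (edges t)"
proof (induction t p rule: pointed_tree_word.induct)
  case (1 t)
  then show ?case
    using card_vertices[of t] card_vertices_Node[of "children t"] by (simp add: length_forest_word)
next
  case (2 t i p)
  then have "children t = take i (children t) @ children t ! i # drop (Suc i) (children t)"
    by (simp add: id_take_nth_drop)
  then have "(\<Sum>s\<leftarrow>children t. card (vertices s)) =
      (\<Sum>s\<leftarrow>take i (children t). card (vertices s)) + card (vertices (children t ! i)) +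
      (\<Sum>s\<leftarrow>drop (Suc i) (children t). card (vertices s))"
    by (metis (no_types, lifting) add.assoc list.simps(9) map_append sum_list.Cons sum_list_append)
  \<comment> \<open>The subtree at the chosen child has one edge fewer than vertices; the exchanged
    pair of steps around it stands for the edge leading to it.\<close>
  with 2 show ?case
    using card_vertices[of t] card_vertices_Node[of "children t"] card_vertices[of "children t ! i"]
    by (simp add: length_forest_word)
qed

section \<open>The bijection\<close>

text \<open>Length and height are the sum and the difference of the numbers of up and down steps,
  and together they are the coordinates of the end point.\<close>

lemma free_dyck_paths_eq:
  "free_dyck_paths n = {w. set w \<subseteq> {up_step, down_step} \<and> height w = 0 \<and> length w = 2 * n}"
proof -
  have "sum_list w = (int (length w), height w) \<and>
      length w = count_list w up_step + count_list w down_step \<and>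
      height w = int (count_list w up_step) - int (count_list w down_step)"
    if "set w \<subseteq> {up_step, down_step}" for w
    using that by (induction w) (auto simp: zero_prod_def)
  then show ?thesis
    unfolding free_dyck_paths_def by fastforce
qed

theorem theorem2p1:
  fixes n :: nat
  shows "\<exists>f. bij_betw f (doubly_rooted_plane_trees n) (free_dyck_paths n)"
proof
  show "bij_betw (\<lambda>(t, v). pointed_tree_word t v) (doubly_rooted_plane_trees n) (free_dyck_paths n)"
  proof (rule bij_betw_imageI)
    show "inj_on (\<lambda>(t, v). pointed_tree_word t v) (doubly_rooted_plane_trees n)"
      by (auto simp: inj_on_def doubly_rooted_plane_trees_def vertices_def
          dest: pointed_tree_word_inject)
    show "(\<lambda>(t, v). pointed_tree_word t v) ` doubly_rooted_plane_trees n = free_dyck_paths n"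
    proof (intro equalityI subsetI)
      fix w assume "w \<in> (\<lambda>(t, v). pointed_tree_word t v) ` doubly_rooted_plane_trees n"
      then show "w \<in> free_dyck_paths n"
        using set_pointed_tree_word
        by (fastforce simp: free_dyck_paths_eq doubly_rooted_plane_trees_def vertices_def
            height_pointed_tree_word length_pointed_tree_word)
    next
      fix w assume w: "w \<in> free_dyck_paths n"
      then obtain t p where "is_vertex t p" "w = pointed_tree_word t p"
        using pointed_tree_word_surj[of w] by (auto simp: free_dyck_paths_eq)
      \<comment> \<open>The length \<open>2 * n\<close> of \<open>w\<close> forces the tree found to
        have \<open>n\<close> edges.\<close>
      with w show "w \<in> (\<lambda>(t, v). pointed_tree_word t v) ` doubly_rooted_plane_trees n"
        by (force simp: free_dyck_paths_eq doubly_rooted_plane_trees_def vertices_def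
            length_pointed_tree_word)
    qed
  qed
qed

end
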